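(* Let $d\ge 1$ and let $\mathcal{A}$ be a nonempty (possibly infinite) family of nonempty finite subsets of $\mathbb{Z}^d$. Then there exists a function $\mathfrak{F}:\mathbb{Z}^d\to\mathbb{Z}_2$ that is stable, but not $0$-stable, with respect to $\mathcal{A}$.
   Context: For $\mathfrak{F}:\mathbb{Z}^d\to\mathbb{Z}_2$ and a finite $A\subset\mathbb{Z}^d$, write $\mathfrak{F}(A)=\sum_{x\in A}\mathfrak{F}(x)\in\mathbb{Z}_2$. $\mathfrak{F}$ is stable with respect to $\mathcal{A}$ if for every $A\in\mathcal{A}$ the value $\mathfrak{F}(A+p)$ is the same for all $p\in\mathbb{Z}^d$. $\mathfrak{F}$ is $0$-stable with respect to $\mathcal{A}$ if it is stable and moreover $\mathfrak{F}(A)=0$ for every $A\in\mathcal{A}$. *)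

theory Defs
  imports "HOL-Analysis.Finite_Cartesian_Product" "HOL-Library.Z2"
begin

text \<open>
  \<open>\<int>\<^sup>d\<close> is rendered as \<open>int ^ 'd\<close> for a type variable \<open>'d\<close> of class \<open>finite\<close>, with
  \<open>d = CARD('d) \<ge> 1\<close>; \<open>\<int>\<^sub>2\<close> is the two-element field \<open>bit\<close> of \<open>HOL-Library.Z2\<close>.
\<close>

definition translate :: "int ^ 'd \<Rightarrow> (int ^ 'd) set \<Rightarrow> (int ^ 'd) set" where
  "translate p A = (\<lambda>x. x + p) ` A"

text \<open>
  \<open>sum F A\<close> is the value \<open>F(A)\<close> only for finite \<open>A\<close>, so the following are meant
  for families of finite sets.
\<close>

definition stable_wrt :: "(int ^ 'd \<Rightarrow> bit) \<Rightarrow> (int ^ 'd) set set \<Rightarrow> bool" where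
  "stable_wrt F \<A> \<longleftrightarrow> (\<forall>A\<in>\<A>. \<forall>p q. sum F (translate p A) = sum F (translate q A))"

definition zero_stable_wrt :: "(int ^ 'd \<Rightarrow> bit) \<Rightarrow> (int ^ 'd) set set \<Rightarrow> bool" where
  "zero_stable_wrt F \<A> \<longleftrightarrow> stable_wrt F \<A> \<and> (\<forall>A\<in>\<A>. sum F A = 0)"

end

theory Submission imports Defs begin

text \<open>
  Call \<open>F\<close> polynomial if some number of iterated differences annihilates it. Among the polynomial
  \<open>F\<close> with a nonzero sum over a translate of some \<open>A \<in> \<A>\<close>, take one of minimal degree: its
  differences have smaller degree, so their sums over all translates vanish, which says precisely
  that \<open>F\<close> is stable. Such \<open>F\<close> exist because \<open>2\<^sup>k\<close>-periodic functions on \<open>\<int>\<close> with values in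
  \<open>\<int>\<^sub>2\<close> are polynomial, so polynomial functions separate points and hence detect every nonempty
  finite set. Algebraically this is the fact that the powers of the augmentation ideal of
  \<open>\<int>\<^sub>2[\<int>\<^sup>d]\<close> have intersection \<open>0\<close>.
\<close>

definition diff :: "'a::ab_group_add \<Rightarrow> ('a \<Rightarrow> bit) \<Rightarrow> 'a \<Rightarrow> bit" where
  "diff p F = (\<lambda>x. F (x + p) - F x)"

text \<open>The bound is strict, so that \<open>poly_deg_less 0\<close> characterises the zero function.\<close>

fun poly_deg_less :: "nat \<Rightarrow> ('a::ab_group_add \<Rightarrow> bit) \<Rightarrow> bool" where
  "poly_deg_less 0 F \<longleftrightarrow> F = (\<lambda>x. 0)"
| "poly_deg_less (Suc n) F \<longleftrightarrow> (\<forall>p. poly_deg_less n (diff p F))"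

lemma diff_commute: "diff p (diff q F) = diff q (diff p F)"
  unfolding diff_def by (rule ext) (simp only: algebra_simps)

lemma poly_deg_less_zero: "poly_deg_less n (\<lambda>x. 0)"
  by (induction n) (simp_all add: diff_def)

lemma poly_deg_less_const: "poly_deg_less (Suc 0) (\<lambda>x. c)"
  by (simp add: diff_def)

lemma poly_deg_less_add:
  "poly_deg_less n F \<Longrightarrow> poly_deg_less n G \<Longrightarrow> poly_deg_less n (\<lambda>x. F x + G x)"
proof (induction n arbitrary: F G)
  case (Suc n)
  have "diff p (\<lambda>x. F x + G x) = (\<lambda>x. diff p F x + diff p G x)" for p
    unfolding diff_def by (rule ext) (simp only: algebra_simps)
  with Suc show ?case by simp
qed simp

lemma poly_deg_less_shift: "poly_deg_less n F \<Longrightarrow> poly_deg_less n (\<lambda>x. F (x + q))"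
proof (induction n arbitrary: F)
  case (Suc n)
  have "diff p (\<lambda>x. F (x + q)) = (\<lambda>x. diff p F (x + q))" for p
    by (simp add: diff_def fun_eq_iff algebra_simps)
  with Suc show ?case by simp
qed simp

text \<open>Leibniz rule: each of the two terms in the difference of a product has one factor
  differenced, which lowers one of the two bounds; hence the induction on
  \<open>m + n\<close>.\<close>

lemma poly_deg_less_mult:
  "poly_deg_less m F \<Longrightarrow> poly_deg_less n G \<Longrightarrow> poly_deg_less (m + n) (\<lambda>x. F x * G x)"
proof (induction "m + n" arbitrary: m n F G)
  case 0
  then show ?case by simp
next
  case (Suc k)
  show ?case
  proof (cases "m = 0 \<or> n = 0")
    case True
    with Suc.prems have "(\<lambda>x. F x * G x) = (\<lambda>x. 0)" by auto
    then show ?thesis by (simp only: poly_deg_less_zero)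
  next
    case False
    then obtain m' n' where mn: "m = Suc m'" "n = Suc n'" by (meson not0_implies_Suc)
    have "poly_deg_less k (diff p (\<lambda>x. F x * G x))" for p
    proof -
      have "poly_deg_less (m + n') (\<lambda>x. F (x + p) * diff p G x)"
        using Suc.prems mn Suc.hyps(2)
        by (intro Suc.hyps(1) poly_deg_less_shift) auto
      moreover have "poly_deg_less (m' + n) (\<lambda>x. diff p F x * G x)"
        using Suc.prems mn Suc.hyps(2) by (intro Suc.hyps(1)) auto
      moreover have "m + n' = k" "m' + n = k" using mn Suc.hyps(2) by auto
      ultimately have "poly_deg_less k (\<lambda>x. F (x + p) * diff p G x + diff p F x * G x)"
        by (metis poly_deg_less_add)
      moreover have "diff p (\<lambda>x. F x * G x) = (\<lambda>x. F (x + p) * diff p G x + diff p F x * G x)"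
        unfolding diff_def by (rule ext) (rule mult_diff_mult)
      ultimately show ?thesis by simp
    qed
    then show ?thesis by (simp flip: Suc.hyps(2))
  qed
qed

lemma poly_deg_less_comp:
  assumes "\<And>x y. h (x + y) = h x + h y" "poly_deg_less n F"
  shows "poly_deg_less n (\<lambda>x. F (h x))"
  using assms(2)
proof (induction n arbitrary: F)
  case (Suc n)
  have "diff p (\<lambda>x. F (h x)) = (\<lambda>x. diff (h p) F (h x))" for p
    by (simp add: diff_def assms(1))
  with Suc show ?case by simp
qed simp

text \<open>Differences commute, so after \<open>m\<close> further differences of \<open>F\<close>
  in any directions the result is annihilated by \<open>diff e\<close>, and the first assumption
  takes over.\<close>

lemma poly_deg_less_if_diff:
  assumes "\<And>H. diff e H = (\<lambda>x. 0) \<Longrightarrow> poly_deg_less n H" "poly_deg_less m (diff e F)"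
  shows "poly_deg_less (m + n) F"
  using assms(2)
proof (induction m arbitrary: F)
  case 0
  then show ?case by (simp add: assms(1))
next
  case (Suc m)
  then show ?case by (metis add_Suc diff_commute poly_deg_less.simps(2))
qed

text \<open>With \<open>T\<close> the shift by \<open>2 ^ k\<close>, characteristic 2 gives
  \<open>(T - 1)^2 = T^2 - 1\<close>. So if \<open>F\<close> has period \<open>2 ^ (k + 1)\<close>,
  its difference by \<open>2 ^ k\<close> has period \<open>2 ^ k\<close>, and the degree bound
  doubles.\<close>

lemma poly_deg_less_periodic:
  fixes F :: "int \<Rightarrow> bit"
  assumes "diff (2 ^ k) F = (\<lambda>x. 0)"
  shows "poly_deg_less (2 ^ k) F"
  using assms
proof (induction k arbitrary: F)
  case 0
  then have step: "F (x + 1) = F x" for x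
    using fun_cong[of _ _ x] by (fastforce simp: diff_def)
  have "F x = F 0" for x
  proof (induction x rule: int_induct[where k = 0])
    case (step1 i)
    then show ?case using step[of i] by metis
  next
    case (step2 i)
    then show ?case using step[of "i - 1"] by (metis diff_add_cancel)
  qed (rule refl)
  then have "F = (\<lambda>x. F 0)" by blast
  then have "poly_deg_less (Suc 0) F" using poly_deg_less_const by metis
  then show ?case by simp
next
  case (Suc k)
  have "F (x + 2 ^ k + 2 ^ k) = F x" for x
    using fun_cong[OF Suc.prems, of x] unfolding diff_def
    by (simp only: right_minus_eq power_Suc mult_2 add.assoc)
  \<comment> \<open>Characteristic 2 enters here, with \<open>a = F x\<close> and
    \<open>b = F (x + 2 ^ k)\<close>.\<close>
  moreover have "a - b - (b - a) = 0" for a b :: bit by (cases a; cases b) simp_all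
  ultimately have "diff (2 ^ k) (diff (2 ^ k) F) = (\<lambda>x. 0)"
    unfolding diff_def by (simp only:)
  then have "poly_deg_less (2 ^ k) (diff (2 ^ k) F)" by (rule Suc.IH)
  then have "poly_deg_less (2 ^ k + 2 ^ k) F"
    by (rule poly_deg_less_if_diff[rotated]) (rule Suc.IH)
  then show ?case by (simp add: mult_2)
qed

lemma poly_separates_points:
  fixes a b :: "int ^ 'd"
  assumes "a \<noteq> b"
  shows "\<exists>n G. poly_deg_less n G \<and> G a = 1 \<and> G b = 0"
proof -
  obtain i where i: "a $ i \<noteq> b $ i" using assms by (auto simp: vec_eq_iff)
  \<comment> \<open>This makes \<open>2 ^ k\<close> larger than the nonzero distance of the
    \<open>i\<close>-th coordinates, so they lie in different classes modulo \<open>2 ^ k\<close>;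
    the indicator of the class of \<open>a $ i\<close> separates the points.\<close>
  define k where "k = nat \<bar>b $ i - a $ i\<bar>"
  have "int k < 2 ^ k" by (metis less_exp of_nat_less_numeral_power_cancel_iff)
  then have "\<not> 2 ^ k dvd b $ i - a $ i"
    using i zdvd_imp_le[of "2 ^ k" "\<bar>b $ i - a $ i\<bar>"] by (auto simp: k_def)
  define F :: "int \<Rightarrow> bit" where "F = (\<lambda>z. of_bool (2 ^ k dvd z - a $ i))"
  have "diff (2 ^ k) F = (\<lambda>x. 0)"
  proof -
    have "2 ^ k dvd x + 2 ^ k - a $ i \<longleftrightarrow> 2 ^ k dvd x - a $ i" for x
      using dvd_add_left_iff[of "2 ^ k" "2 ^ k" "x - a $ i"] by (simp add: algebra_simps)
    then show ?thesis by (simp add: diff_def F_def)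
  qed
  then have "poly_deg_less (2 ^ k) F" by (rule poly_deg_less_periodic)
  then have "poly_deg_less (2 ^ k) (\<lambda>x :: int ^ 'd. F (x $ i))"
    by (rule poly_deg_less_comp[where h = "\<lambda>x. x $ i", rotated]) (rule vector_add_component)
  moreover have "F (a $ i) = 1" "F (b $ i) = 0"
    using \<open>\<not> 2 ^ k dvd b $ i - a $ i\<close> by (simp_all add: F_def)
  ultimately show ?thesis by blast
qed

text \<open>Multiplication by a polynomial 0-1 function that separates two points of
  \<open>A\<close> restricts the sum to a smaller nonempty subset, down to a singleton, where the
  constant 1 works.\<close>

lemma poly_detects_finite:
  fixes A :: "(int ^ 'd) set"
  assumes "finite A" "A \<noteq> {}"
  shows "\<exists>n F. poly_deg_less n F \<and> sum F A \<noteq> 0"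
  using assms
proof (induction A rule: finite_psubset_induct)
  case (psubset A)
  then obtain a where a: "a \<in> A" by blast
  show ?case
  proof (cases "A = {a}")
    case True
    then show ?thesis using poly_deg_less_const[of 1] by fastforce
  next
    case False
    then obtain b where b: "b \<in> A" "a \<noteq> b" using a by blast
    obtain n G where G: "poly_deg_less n G" "G a = 1" "G b = 0"
      using poly_separates_points[OF b(2)] by blast
    define B where "B = {x \<in> A. G x = 1}"
    have "B \<subset> A" "B \<noteq> {}" using a b G unfolding B_def by force+
    then obtain m F where F: "poly_deg_less m F" "sum F B \<noteq> 0" using psubset.IH by blast
    have "sum F B = (\<Sum>x\<in>A. F x * G x)"
      unfolding B_def sum.inter_filter[OF psubset.hyps]
      by (rule sum.cong) (simp_all)
    with F G show ?thesis using poly_deg_less_mult by metis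
  qed
qed

lemma sum_translate: "sum F (translate p A) = (\<Sum>x\<in>A. F (x + p))"
  by (simp add: translate_def sum.reindex)

theorem theorem2:
  fixes \<A> :: "(int ^ 'd) set set"
  assumes "\<A> \<noteq> {}"
    and "\<And>A. A \<in> \<A> \<Longrightarrow> finite A \<and> A \<noteq> {}"
  shows "\<exists>F :: int ^ 'd \<Rightarrow> bit. stable_wrt F \<A> \<and> \<not> zero_stable_wrt F \<A>"
proof -
  define P where "P n \<longleftrightarrow> (\<exists>F. poly_deg_less n F \<and> (\<exists>A\<in>\<A>. \<exists>p. sum F (translate p A) \<noteq> 0))" for n
  obtain A where A: "A \<in> \<A>" using assms(1) by blast
  then obtain n F where "poly_deg_less n F" "sum F A \<noteq> 0"
    using poly_detects_finite assms(2) by blast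
  then have "poly_deg_less n F" "sum F (translate 0 A) \<noteq> 0" by (simp_all add: sum_translate)
  with A have "P n" unfolding P_def by blast
  define m where "m = (LEAST n. P n)"
  have "P m" unfolding m_def using \<open>P n\<close> by (rule LeastI)
  then obtain F A p where F: "poly_deg_less m F" and A: "A \<in> \<A>" "sum F (translate p A) \<noteq> 0"
    unfolding P_def by blast
  then have "m \<noteq> 0" by (auto intro: ccontr)
  then obtain m' where m': "m = Suc m'" by (meson not0_implies_Suc)
  then have "\<not> P m'" unfolding m_def using not_less_Least by (metis lessI)
  then have "sum (diff q F) (translate 0 B) = 0" if "B \<in> \<A>" for q B
    using F that unfolding P_def m' by auto
  then have transl: "sum F (translate q B) = sum F B" if "B \<in> \<A>" for q B
    using that by (simp only: sum_translate diff_def sum_subtractf right_minus_eq add_0_right)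
  then have "stable_wrt F \<A>" by (simp add: stable_wrt_def)
  \<comment> \<open>By stability, the nonzero sum over a translate of \<open>A\<close> is also the
    sum over \<open>A\<close> itself.\<close>
  moreover have "\<not> zero_stable_wrt F \<A>" using A transl by (auto simp: zero_stable_wrt_def)
  ultimately show ?thesis by blast
qed

end
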